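(* Let $n\geq 2$ and let $k$ be a domain. Let $f$ be a stable coordinate of $k[\mathbf{x}]=k[x_1,\ldots,x_n]$ over $k$. Then, for each $\mathbf{w}=(w_1,\ldots,w_n)\in\Gamma^n$, there exists $1\leq i\leq n$ such that $\deg_{\mathbf{w}}f$ belongs to $\sum_{l\neq i}\mathbb{Z}_{\geq 0}w_l$.
   Context: An element $f\in k[x_1,\ldots,x_n]$ is a coordinate of $k[x_1,\ldots,x_n]$ over $k$ if $f=F(x_i)$ for some $k$-algebra automorphism $F$ of $k[x_1,\ldots,x_n]$ and some $1\leq i\leq n$. It is a stable coordinate of $k[x_1,\ldots,x_n]$ over $k$ if it is a coordinate of $k[x_1,\ldots,x_m]$ over $k$ for some $m\geq n$. $\Gamma$ is a totally ordered additive group, i.e. an additive (abelian) group with a total ordering such that $\alpha\leq\beta$ implies $\alpha+\gamma\leq\beta+\gamma$. For $\mathbf{w}\in\Gamma^n$ and nonzero $f\in k[\mathbf{x}]$, $\deg_{\mathbf{w}}f$ is the maximum of $\sum_i a_iw_i$ over the monomials $x_1^{a_1}\cdots x_n^{a_n}$ appearing in $f$ with nonzero coefficient. $\sum_{l\neq i}\mathbb{Z}_{\geq 0}w_l$ is the set of sums $\sum_{l\neq i}a_lw_l$ with $a_l\in\mathbb{Z}_{\geq 0}$. *)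

theory Defs
  imports Main "HOL-Library.Poly_Mapping"
begin

text \<open>
  Polynomials in the variables \<open>x\<^sub>i\<close>, \<open>i :: nat\<close>, over \<open>'a\<close>: finitely supported
  functions from exponent vectors to coefficients, with the convolution product of
  \<^theory>\<open>HOL-Library.Poly_Mapping\<close>. All the rings \<open>k[x\<^sub>1, \<dots>, x\<^sub>n]\<close> are subsets of this one
  type, so for \<open>n \<le> m\<close> the inclusion \<open>k[x\<^sub>1, \<dots>, x\<^sub>n] \<subseteq> k[x\<^sub>1, \<dots>, x\<^sub>m]\<close> is literal.
\<close>

type_synonym 'a mpol = "(nat \<Rightarrow>\<^sub>0 nat) \<Rightarrow>\<^sub>0 'a"

definition var :: "nat \<Rightarrow> 'a::comm_ring_1 mpol" where
  "var i = Poly_Mapping.single (Poly_Mapping.single i 1) 1"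

definition const :: "'a \<Rightarrow> 'a::comm_ring_1 mpol" where
  "const c = Poly_Mapping.single 0 c"

definition poly_ring :: "nat \<Rightarrow> 'a::comm_ring_1 mpol set" where
  "poly_ring n = {p. \<forall>a \<in> Poly_Mapping.keys p. Poly_Mapping.keys a \<subseteq> {1..n}}"

text \<open>
  The values of \<open>F\<close> outside \<open>poly_ring n\<close> are irrelevant. Preservation of \<open>1\<close> is the
  instance \<open>c = 1\<close> of the last condition.
\<close>

definition alg_automorphism :: "nat \<Rightarrow> ('a::comm_ring_1 mpol \<Rightarrow> 'a mpol) \<Rightarrow> bool" where
  "alg_automorphism n F \<longleftrightarrow>
     bij_betw F (poly_ring n) (poly_ring n) \<and>
     (\<forall>p \<in> poly_ring n. \<forall>q \<in> poly_ring n. F (p + q) = F p + F q) \<and>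
     (\<forall>p \<in> poly_ring n. \<forall>q \<in> poly_ring n. F (p * q) = F p * F q) \<and>
     (\<forall>c. F (const c) = const c)"

definition coordinate :: "nat \<Rightarrow> 'a::comm_ring_1 mpol \<Rightarrow> bool" where
  "coordinate n f \<longleftrightarrow> (\<exists>F. alg_automorphism n F \<and> (\<exists>i \<in> {1..n}. f = F (var i)))"

definition stable_coordinate :: "nat \<Rightarrow> 'a::comm_ring_1 mpol \<Rightarrow> bool" where
  "stable_coordinate n f \<longleftrightarrow> f \<in> poly_ring n \<and> (\<exists>m \<ge> n. coordinate m f)"

definition nat_mult :: "nat \<Rightarrow> 'g::comm_monoid_add \<Rightarrow> 'g" where
  "nat_mult a g = (\<Sum>_<a. g)"

text \<open>
  A weight vector \<open>(w\<^sub>1, \<dots>, w\<^sub>n)\<close> is a function on \<open>nat\<close> of which only the values at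
  \<open>1, \<dots>, n\<close> are used. The degree is meaningful for nonzero \<open>f\<close> only (\<^const>\<open>Max\<close> of the
  empty set is unspecified).
\<close>

definition wdeg :: "nat \<Rightarrow> (nat \<Rightarrow> 'g::linordered_ab_group_add) \<Rightarrow> 'a::comm_ring_1 mpol \<Rightarrow> 'g" where
  "wdeg n w f = Max ((\<lambda>a. \<Sum>i = 1..n. nat_mult (Poly_Mapping.lookup a i) (w i)) ` Poly_Mapping.keys f)"

definition weight_sums :: "nat set \<Rightarrow> (nat \<Rightarrow> 'g::comm_monoid_add) \<Rightarrow> 'g set" where
  "weight_sums I w = {\<Sum>l \<in> I. nat_mult (a l) (w l) | a :: nat \<Rightarrow> nat. True}"

end

theory Submission
  imports Defs Complex_Main
begin

text \<open>
  Suppose that the conclusion fails. Then every exponent of \<open>f\<close> of maximal \<open>w\<close>-degree has all its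
  entries \<open>1, \<dots>, n\<close> positive. The proof shows that some exponent of maximal \<open>w\<close>-degree has a zero
  entry, as follows.

  First, \<open>\<Gamma>\<close> is replaced by the reals. Breaking ties between exponents of equal \<open>w\<close>-degree by a
  lexicographic order singles out one exponent \<open>a\<close> of \<open>f\<close>, and Fourier-Motzkin elimination turns the
  finitely many strict inequalities that say that \<open>a\<close> is the largest exponent into real weights
  \<open>u\<^sub>1, \<dots>, u\<^sub>n\<close> for which \<open>a\<close> is the only exponent of \<open>f\<close> of maximal weight
  (\<open>real_weights_for_finite_set\<close>). In other words, \<open>a\<close> is a vertex of the Newton polytope.

  Second, a coordinate is fixed by many automorphisms that depend on a parameter \<open>t\<close>. If \<open>f = F(x\<^sub>i)\<close>,
  then for each \<open>j \<noteq> i\<close> the substitution \<open>x\<^sub>j \<mapsto> x\<^sub>j + t\<close>, conjugated by \<open>F\<close>, fixes \<open>f\<close> and is the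
  identity at \<open>t = 0\<close>. A polynomial invariant under all of these lies in \<open>k[f]\<close>, so if \<open>x\<^sub>1 \<notin> k[f]\<close>,
  then one of these families moves \<open>x\<^sub>1\<close> (\<open>coordinate_shift_family\<close>). If all \<open>a\<^sub>i\<close> were
  positive, \<open>f\<close> would involve \<open>x\<^sub>2\<close> and hence \<open>x\<^sub>1 \<notin> k[f]\<close>. The shifts may involve variables \<open>x\<^sub>l\<close> with \<open>l > n\<close>; this is harmless, since only
  their effect on \<open>x\<^sub>1, \<dots>, x\<^sub>n\<close> matters. Such families take the place of locally nilpotent derivations
  and make the argument independent of the characteristic.

  Third, let \<open>x\<^sub>i \<mapsto> R\<^sub>i\<close> be such a family and give \<open>t\<close> a weight. For a very negative weight
  the degree of \<open>R\<^sub>i\<close> is \<open>u\<^sub>i\<close> for every \<open>i\<close>, because \<open>R\<^sub>i = x\<^sub>i\<close> at \<open>t = 0\<close>. Raise the weight of \<open>t\<close>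
  just past the point where some \<open>t\<close>-term reaches degree \<open>u\<^sub>i\<close>: now \<open>deg R\<^sub>i = u\<^sub>i + e\<^sub>i\<close> with all \<open>e\<^sub>i\<close>
  nonnegative and tiny, and at least one \<open>e\<^sub>i\<close> positive. As the \<open>e\<^sub>i\<close> are tiny, the exponent
  \<open>a\<close> still dominates strictly, and as degrees add up in a domain, \<open>f = f(R\<^sub>1, \<dots>, R\<^sub>n)\<close> has degree
  \<open>\<Sum> a\<^sub>i (u\<^sub>i + e\<^sub>i)\<close>. But \<open>f\<close> has degree \<open>\<Sum> a\<^sub>i u\<^sub>i\<close>. Hence \<open>a\<^sub>i = 0\<close> whenever \<open>e\<^sub>i > 0\<close>
  (\<open>invariant_top_exponent_has_zero\<close>).

  The parameter \<open>t\<close> is the variable with index \<open>0\<close>, which does not occur in \<open>k[x\<^sub>1, \<dots>, x\<^sub>m]\<close>.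
\<close>

section \<open>Substitution\<close>

definition supported_in :: "nat set \<Rightarrow> 'a::comm_ring_1 mpol set" where
  "supported_in A = {p. \<forall>a \<in> Poly_Mapping.keys p. Poly_Mapping.keys a \<subseteq> A}"

definition monom_value :: "(nat \<Rightarrow> 'a::comm_ring_1 mpol) \<Rightarrow> (nat \<Rightarrow>\<^sub>0 nat) \<Rightarrow> 'a mpol" where
  "monom_value R a = (\<Prod>i \<in> Poly_Mapping.keys a. R i ^ Poly_Mapping.lookup a i)"

definition subst :: "(nat \<Rightarrow> 'a::comm_ring_1 mpol) \<Rightarrow> 'a mpol \<Rightarrow> 'a mpol" where
  "subst R p = (\<Sum>a \<in> Poly_Mapping.keys p. const (Poly_Mapping.lookup p a) * monom_value R a)"

lemma poly_ring_eq_supported_in: "poly_ring n = supported_in {1..n}"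
  by (simp add: poly_ring_def supported_in_def)

lemma sum_singles: "(\<Sum>a \<in> Poly_Mapping.keys p. Poly_Mapping.single a (Poly_Mapping.lookup p a)) = p"
proof (rule poly_mapping_eqI)
  fix k
  show "Poly_Mapping.lookup (\<Sum>a \<in> Poly_Mapping.keys p. Poly_Mapping.single a (Poly_Mapping.lookup p a)) k
      = Poly_Mapping.lookup p k"
    by (simp add: lookup_sum lookup_single when_def sum.delta' in_keys_iff)
qed

lemma const_simps [simp]:
  "const 0 = 0" "const 1 = 1" "const (b + c) = const b + const c" "const (b * c) = const b * const c"
  by (simp_all add: const_def single_add mult_single)

lemma monom_value_superset:
  assumes "finite S" "Poly_Mapping.keys a \<subseteq> S"
  shows "monom_value R a = (\<Prod>i \<in> S. R i ^ Poly_Mapping.lookup a i)"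
  unfolding monom_value_def
  by (rule prod.mono_neutral_left) (use assms in \<open>auto simp: in_keys_iff\<close>)

lemma monom_value_add: "monom_value R (a + b) = monom_value R a * monom_value R b"
proof -
  let ?S = "Poly_Mapping.keys a \<union> Poly_Mapping.keys b"
  have "monom_value R (a + b) = (\<Prod>i \<in> ?S. R i ^ Poly_Mapping.lookup (a + b) i)"
    by (rule monom_value_superset) (use keys_add[of a b] in auto)
  also have "\<dots> = monom_value R a * monom_value R b"
    by (simp add: monom_value_superset[of ?S] lookup_add power_add prod.distrib)
  finally show ?thesis .
qed

lemma monom_value_zero [simp]: "monom_value R 0 = 1"
  by (simp add: monom_value_def)

lemma monom_value_var: "monom_value var a = Poly_Mapping.single a 1"
proof -
  have pow: "var i ^ k = (Poly_Mapping.single (Poly_Mapping.single i k) 1 :: 'a mpol)" for i k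
    by (induction k) (simp_all add: var_def mult_single flip: single_add)
  have "(\<Prod>i \<in> S. Poly_Mapping.single (g i) 1) = (Poly_Mapping.single (\<Sum>i \<in> S. g i) 1 :: 'a mpol)"
    for S :: "nat set" and g
    by (induction S rule: infinite_finite_induct) (simp_all add: mult_single)
  then show ?thesis
    by (simp add: monom_value_def pow sum_singles)
qed

lemma subst_add: "subst R (p + q) = subst R p + subst R q"
  unfolding subst_def by (rule setsum_keys_plus_distrib) (simp_all add: algebra_simps)

lemma subst_zero [simp]: "subst R 0 = 0"
  by (simp add: subst_def)

lemma subst_single: "subst R (Poly_Mapping.single a c) = const c * monom_value R a"
  by (simp add: subst_def)

lemma subst_sum: "subst R (\<Sum>x \<in> S. g x) = (\<Sum>x \<in> S. subst R (g x))"
  by (induction S rule: infinite_finite_induct) (simp_all add: subst_add)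

lemma subst_const [simp]: "subst R (const c) = const c"
  by (simp add: const_def subst_single[unfolded const_def])

lemma subst_var [simp]: "subst R (var i) = R i"
  by (simp add: var_def subst_single) (simp add: monom_value_def)

lemma subst_mult: "subst R (p * q) = subst R p * subst R q"
proof -
  let ?s = "\<lambda>p a. Poly_Mapping.single a (Poly_Mapping.lookup p a)"
  have "subst R (p * q)
      = subst R ((\<Sum>a \<in> Poly_Mapping.keys p. ?s p a) * (\<Sum>b \<in> Poly_Mapping.keys q. ?s q b))"
    by (simp add: sum_singles)
  also have "\<dots> = (\<Sum>a \<in> Poly_Mapping.keys p. \<Sum>b \<in> Poly_Mapping.keys q.
      subst R (?s p a) * subst R (?s q b))"
    by (simp add: sum_product subst_sum mult_single subst_single monom_value_add mult_ac)
  also have "\<dots> = subst R p * subst R q"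
    unfolding sum_product[symmetric] subst_sum[symmetric] sum_singles ..
  finally show ?thesis .
qed

lemma supported_in_closed:
  "const c \<in> supported_in A"
  "i \<in> A \<Longrightarrow> var i \<in> supported_in A"
  "p \<in> supported_in A \<Longrightarrow> q \<in> supported_in A \<Longrightarrow> p + q \<in> supported_in A"
  "p \<in> supported_in A \<Longrightarrow> q \<in> supported_in A \<Longrightarrow> p * q \<in> supported_in A"
  by (fastforce simp: supported_in_def const_def var_def keys_add[THEN subsetD]
      dest: subsetD[OF keys_add] subsetD[OF keys_mult])+

text \<open>
  The polynomials in the variables indexed by \<open>A\<close> form the algebra generated by these variables.
  This is how identities between algebra homomorphisms get reduced to their values on variables.
\<close>

lemma supported_in_induct [consumes 1, case_names const var add mult]:
  assumes p: "p \<in> supported_in A"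
    and const: "\<And>c. P (const c)"
    and var: "\<And>i. i \<in> A \<Longrightarrow> P (var i)"
    and add: "\<And>p q. p \<in> supported_in A \<Longrightarrow> q \<in> supported_in A \<Longrightarrow> P p \<Longrightarrow> P q \<Longrightarrow> P (p + q)"
    and mult: "\<And>p q. p \<in> supported_in A \<Longrightarrow> q \<in> supported_in A \<Longrightarrow> P p \<Longrightarrow> P q \<Longrightarrow> P (p * q)"
  shows "P p"
proof -
  let ?Q = "\<lambda>p. p \<in> supported_in A \<and> P p"
  have zero: "?Q 0" and one: "?Q 1"
    using const[of 0] const[of 1] supported_in_closed(1)[of 0 A] supported_in_closed(1)[of 1 A] by auto
  have pow: "?Q (var i ^ k)" if "i \<in> A" for i k
    by (induction k) (use one var that in \<open>auto intro!: mult supported_in_closed\<close>)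
  have "?Q (\<Prod>i \<in> S. var i ^ k i)" if "finite S" "S \<subseteq> A" for S k
    using that by (induction S rule: finite_induct)
      (use one pow in \<open>auto intro!: mult supported_in_closed\<close>)
  then have single: "?Q (const c * monom_value var a)" if "Poly_Mapping.keys a \<subseteq> A" for a c
    using that const by (auto simp: monom_value_def intro!: mult supported_in_closed)
  have "?Q (\<Sum>a \<in> S. const (g a) * monom_value var a)"
    if "finite S" "S \<subseteq> Poly_Mapping.keys p" for S g
    using that
  proof (induction S rule: finite_induct)
    case (insert a S)
    then have "Poly_Mapping.keys a \<subseteq> A"
      using p by (auto simp: supported_in_def)
    then show ?case
      using insert single[of a "g a"] by (auto intro!: add supported_in_closed(3))
  qed (use zero in simp)
  from this[of "Poly_Mapping.keys p" "Poly_Mapping.lookup p"] show ?thesis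
    by (simp add: monom_value_var const_def mult_single sum_singles)
qed

lemma supported_in_UNIV [simp]: "p \<in> supported_in UNIV"
  by (simp add: supported_in_def)

lemma subst_cong:
  assumes "p \<in> supported_in A" "\<And>i. i \<in> A \<Longrightarrow> R i = S i"
  shows "subst R p = subst S p"
  using assms(1) by (induction rule: supported_in_induct) (simp_all add: assms(2) subst_add subst_mult)

lemma subst_subst: "subst R (subst S p) = subst (\<lambda>i. subst R (S i)) p"
  using supported_in_UNIV[of p] by (induction rule: supported_in_induct) (simp_all add: subst_add subst_mult)

lemma subst_id:
  assumes "p \<in> supported_in A" "\<And>i. i \<in> A \<Longrightarrow> R i = var i"
  shows "subst R p = p"
  using assms(1) by (induction rule: supported_in_induct) (simp_all add: assms(2) subst_add subst_mult)

lemma subst_in_supported_in: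
  assumes "p \<in> supported_in A" "\<And>i. i \<in> A \<Longrightarrow> R i \<in> supported_in B"
  shows "subst R p \<in> supported_in B"
  using assms(1)
  by (induction rule: supported_in_induct)
    (simp_all add: assms(2) subst_add subst_mult supported_in_closed)

text \<open>
  This detects the terms of a family that are free of its parameter: if the family is the identity at
  parameter value \<open>0\<close>, then \<open>x\<^sub>i\<close> is the only such term in the image of \<open>x\<^sub>i\<close>.
\<close>

lemma lookup_subst_var_zero:
  assumes "Poly_Mapping.lookup c j = 0"
  shows "Poly_Mapping.lookup (subst (var(j := 0)) p) c = Poly_Mapping.lookup p c"
proof -
  have mv: "monom_value (var(j := 0)) a
      = (if Poly_Mapping.lookup a j = 0 then Poly_Mapping.single a 1 else 0 :: 'a mpol)" for a
  proof (cases "Poly_Mapping.lookup a j = 0")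
    case True
    then have "monom_value (var(j := 0)) a = (monom_value var a :: 'a mpol)"
      unfolding monom_value_def by (intro prod.cong) (auto simp: in_keys_iff)
    then show ?thesis using True by (simp add: monom_value_var)
  next
    case False
    then show ?thesis
      by (auto simp: monom_value_def in_keys_iff zero_power intro!: prod_zero bexI[of _ j])
  qed
  have "Poly_Mapping.lookup (subst (var(j := 0)) p) c
      = (\<Sum>a \<in> Poly_Mapping.keys p. if c = a then Poly_Mapping.lookup p a else 0)"
    using assms unfolding subst_def lookup_sum mv
    by (intro sum.cong) (auto simp: const_def mult_single lookup_single when_def)
  then show ?thesis
    by (simp add: in_keys_iff)
qed

section \<open>Weighted degrees\<close>

definition weight :: "(nat \<Rightarrow> real) \<Rightarrow> (nat \<Rightarrow>\<^sub>0 nat) \<Rightarrow> real" where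
  "weight v a = (\<Sum>i \<in> Poly_Mapping.keys a. real (Poly_Mapping.lookup a i) * v i)"

lemma weight_superset:
  assumes "finite S" "Poly_Mapping.keys a \<subseteq> S"
  shows "weight v a = (\<Sum>i \<in> S. real (Poly_Mapping.lookup a i) * v i)"
  unfolding weight_def
  by (rule sum.mono_neutral_left) (use assms in \<open>auto simp: in_keys_iff\<close>)

lemma weight_add: "weight v (a + b) = weight v a + weight v b"
  unfolding weight_def by (rule setsum_keys_plus_distrib) (simp_all add: algebra_simps)

lemma weight_zero [simp]: "weight v 0 = 0"
  by (simp add: weight_def)

text \<open>
  A relation instead of a function: the degree of \<open>0\<close> is undefined, and upper bounds on the degrees of
  sums and products are stated on single exponents.
\<close>

definition has_degree :: "(nat \<Rightarrow> real) \<Rightarrow> 'a::zero mpol \<Rightarrow> real \<Rightarrow> bool" where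
  "has_degree v p d \<longleftrightarrow>
     (\<forall>c \<in> Poly_Mapping.keys p. weight v c \<le> d) \<and> (\<exists>c \<in> Poly_Mapping.keys p. weight v c = d)"

lemma has_degree_unique: "has_degree v p d \<Longrightarrow> has_degree v p e \<Longrightarrow> d = e"
  unfolding has_degree_def by (metis order_antisym)

lemma has_degree_nonzero: "has_degree v p d \<Longrightarrow> p \<noteq> 0"
  by (auto simp: has_degree_def)

lemma has_degree_const: "c \<noteq> 0 \<Longrightarrow> has_degree v (const c) 0"
  by (simp add: has_degree_def const_def)

lemma has_degree_var: "has_degree v (var i :: 'a::idom mpol) (v i)"
  by (simp add: has_degree_def var_def weight_def)

lemma has_degree_exists:
  assumes "p \<noteq> 0"
  obtains d where "has_degree v p d"
proof
  let ?W = "weight v ` Poly_Mapping.keys p"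
  have "Poly_Mapping.keys p \<noteq> {}" using assms by (metis keys_eq_empty)
  then have "Max ?W \<in> ?W" by (intro Max_in) auto
  then show "has_degree v p (Max ?W)"
    by (auto simp: has_degree_def)
qed

lemma weight_less_mult:
  assumes "\<And>a. a \<in> Poly_Mapping.keys p \<Longrightarrow> weight v a < d"
    and "\<And>b. b \<in> Poly_Mapping.keys q \<Longrightarrow> weight v b \<le> e"
    and "c \<in> Poly_Mapping.keys (p * q)"
  shows "weight v c < d + e"
proof -
  obtain a b where "c = a + b" "a \<in> Poly_Mapping.keys p" "b \<in> Poly_Mapping.keys q"
    using subsetD[OF keys_mult assms(3)] by blast
  then show ?thesis
    using assms(1)[of a] assms(2)[of b] by (simp add: weight_add)
qed

text \<open>
  The product of the leading forms is nonzero since the polynomials over a domain form a domain, and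
  it cannot be cancelled, since all other contributions to the product have smaller weight.
\<close>

lemma has_degree_mult:
  fixes p q :: "'a::idom mpol"
  assumes p: "has_degree v p d" and q: "has_degree v q e"
  shows "has_degree v (p * q) (d + e)"
proof -
  \<comment> \<open>The homogeneous part of weight \<open>d\<close>, that is, the leading form if \<open>d\<close> is the degree.\<close>
  define top :: "real \<Rightarrow> 'a mpol \<Rightarrow> 'a mpol" where
    "top d p = (\<Sum>a \<in> {a \<in> Poly_Mapping.keys p. weight v a = d}.
        Poly_Mapping.single a (Poly_Mapping.lookup p a))" for d p
  have lookup_top: "Poly_Mapping.lookup (top d p) a
      = (if weight v a = d then Poly_Mapping.lookup p a else 0)" for d p a
    by (auto simp: top_def lookup_sum lookup_single when_def sum.delta' in_keys_iff)
  have keys_top: "weight v a = d" if "a \<in> Poly_Mapping.keys (top d p)" for a d p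
    using that by (auto simp: in_keys_iff lookup_top split: if_splits)
  have top_nonzero: "top d p \<noteq> 0" if p: "has_degree v p d" for d p
  proof -
    obtain a where "Poly_Mapping.lookup p a \<noteq> 0" "weight v a = d"
      using p by (auto simp: has_degree_def in_keys_iff)
    then have "Poly_Mapping.lookup (top d p) a \<noteq> 0"
      by (simp add: lookup_top)
    then show ?thesis by auto
  qed
  have keys_rest: "weight v a < d"
    if p: "has_degree v p d" and a: "a \<in> Poly_Mapping.keys (p - top d p)" for a d p
  proof -
    have "a \<in> Poly_Mapping.keys p" "weight v a \<noteq> d"
      using a by (auto simp: in_keys_iff lookup_minus lookup_top split: if_splits)
    with p show ?thesis by (force simp: has_degree_def)
  qed
  have "top d p * top e q \<noteq> 0"
    using top_nonzero p q by simp
  then obtain c where c: "c \<in> Poly_Mapping.keys (top d p * top e q)"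
    by (metis keys_eq_empty ex_in_conv)
  then have wc: "weight v c = d + e"
    using subsetD[OF keys_mult c] keys_top by (auto simp: weight_add)
  have split: "p * q = top d p * top e q + ((p - top d p) * q + (q - top e q) * top d p)"
    by (simp add: algebra_simps)
  have "c \<notin> Poly_Mapping.keys ((p - top d p) * q)"
    using weight_less_mult[of "p - top d p" v d q e c] keys_rest[OF p] q wc
    by (force simp: has_degree_def)
  moreover have "c \<notin> Poly_Mapping.keys ((q - top e q) * top d p)"
    using weight_less_mult[of "q - top e q" v e "top d p" d c] keys_rest[OF q] keys_top wc
    by force
  ultimately have "c \<in> Poly_Mapping.keys (p * q)"
    using c by (subst split) (simp add: in_keys_iff lookup_add)
  moreover have "weight v c' \<le> d + e" if c': "c' \<in> Poly_Mapping.keys (p * q)" for c'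
  proof -
    obtain a b where "c' = a + b" "a \<in> Poly_Mapping.keys p" "b \<in> Poly_Mapping.keys q"
      using subsetD[OF keys_mult c'] by blast
    then show ?thesis
      using p q by (auto simp: weight_add has_degree_def intro!: add_mono)
  qed
  ultimately show ?thesis
    using wc by (auto simp: has_degree_def)
qed

lemma has_degree_monom_value:
  fixes R :: "nat \<Rightarrow> 'a::idom mpol"
  assumes "\<And>i. i \<in> Poly_Mapping.keys a \<Longrightarrow> has_degree v (R i) (d i)"
  shows "has_degree v (monom_value R a) (weight d a)"
proof -
  have one: "has_degree v (1 :: 'a mpol) 0"
    using has_degree_const[of "1::'a" v] by simp
  have pow: "has_degree v (R i ^ k) (real k * d i)" if "i \<in> Poly_Mapping.keys a" for i k
    by (induction k) (use one has_degree_mult[OF assms[OF that]] in \<open>simp_all add: distrib_right\<close>)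
  have "has_degree v (\<Prod>i \<in> S. R i ^ k i) (\<Sum>i \<in> S. real (k i) * d i)"
    if "finite S" "S \<subseteq> Poly_Mapping.keys a" for S k
    using that by (induction S rule: finite_induct) (auto simp: one intro!: has_degree_mult pow)
  then show ?thesis
    by (simp add: monom_value_def weight_def)
qed

text \<open>
  If one monomial of \<open>p\<close> dominates strictly for the weights \<open>d\<close>, the degrees of the polynomials
  substituted for the variables, then nothing can cancel the leading form of its image.
\<close>

lemma has_degree_subst:
  fixes R :: "nat \<Rightarrow> 'a::idom mpol"
  assumes p: "p \<in> supported_in A"
    and R: "\<And>i. i \<in> A \<Longrightarrow> has_degree v (R i) (d i)"
    and a: "a \<in> Poly_Mapping.keys p"
    and top: "\<And>b. b \<in> Poly_Mapping.keys p \<Longrightarrow> b \<noteq> a \<Longrightarrow> weight d b < weight d a"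
  shows "has_degree v (subst R p) (weight d a)"
proof -
  let ?t = "\<lambda>b. const (Poly_Mapping.lookup p b) * monom_value R b"
  have summand: "has_degree v (?t b) (weight d b)" if "b \<in> Poly_Mapping.keys p" for b
  proof -
    have "Poly_Mapping.keys b \<subseteq> A" "Poly_Mapping.lookup p b \<noteq> 0"
      using p that by (auto simp: supported_in_def in_keys_iff)
    then have "has_degree v (?t b) (0 + weight d b)"
      by (intro has_degree_mult has_degree_const has_degree_monom_value R) auto
    then show ?thesis by simp
  qed
  let ?rest = "\<Sum>b \<in> Poly_Mapping.keys p - {a}. ?t b"
  have split: "subst R p = ?t a + ?rest"
    unfolding subst_def using a by (simp add: sum.remove)
  have rest: "weight v c < weight d a" if c: "c \<in> Poly_Mapping.keys ?rest" for c
  proof -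
    obtain b where "b \<in> Poly_Mapping.keys p" "b \<noteq> a" "c \<in> Poly_Mapping.keys (?t b)"
      using c keys_sum[of ?t "Poly_Mapping.keys p - {a}"] by blast
    then show ?thesis
      using summand[of b] top[of b] by (force simp: has_degree_def)
  qed
  obtain c where c: "c \<in> Poly_Mapping.keys (?t a)" "weight v c = weight d a"
    using summand[OF a] by (auto simp: has_degree_def)
  then have "c \<notin> Poly_Mapping.keys ?rest"
    using rest by fastforce
  with c have "c \<in> Poly_Mapping.keys (subst R p)"
    unfolding split by (simp add: in_keys_iff lookup_add)
  moreover have "weight v c' \<le> weight d a" if "c' \<in> Poly_Mapping.keys (subst R p)" for c'
    using that[unfolded split] subsetD[OF keys_add] rest summand[OF a]
    by (fastforce simp: has_degree_def)
  ultimately show ?thesis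
    using c(2) by (auto simp: has_degree_def)
qed

section \<open>From ordered groups to real weights\<close>

lemma real_between_finite_sets:
  fixes L U :: "real set"
  assumes "finite L" "finite U" "\<And>l u. l \<in> L \<Longrightarrow> u \<in> U \<Longrightarrow> l < u"
  obtains r where "\<And>l. l \<in> L \<Longrightarrow> l < r" "\<And>u. u \<in> U \<Longrightarrow> r < u"
proof -
  have "\<exists>r. (\<forall>l \<in> L. l < r) \<and> (\<forall>u \<in> U. r < u)"
    using assms(1,3)
  proof (induction L rule: finite_induct)
    case empty
    show ?case
    proof (cases "U = {}")
      case False
      then have "\<forall>u \<in> U. Min U - 1 < u"
        using assms(2) Min_le by fastforce
      then show ?thesis by blast
    qed simp
  next
    case (insert l L)
    then obtain r where r: "\<forall>l \<in> L. l < r" "\<forall>u \<in> U. r < u" by auto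
    show ?case
    proof (cases "l < r \<or> U = {}")
      case True
      \<comment> \<open>The witness is \<open>r\<close> itself unless \<open>U\<close> is empty, when there is no obstacle to passing \<open>l\<close>.\<close>
      with r show ?thesis
        by (intro exI[of _ "max r (if U = {} then l + 1 else r)"]) auto
    next
      case False
      then have "l < Min U" "r \<le> l"
        using assms(2) insert.prems by auto
      then obtain s where "l < s" "s < Min U"
        using dense by blast
      moreover have "\<forall>t \<in> U. Min U \<le> t"
        using assms(2) by simp
      ultimately show ?thesis
        using r(1) \<open>r \<le> l\<close> by (intro exI[of _ s]) force
    qed
  qed
  then show thesis using that by blast
qed

text \<open>
  A finite set of integer vectors in an additive semigroup that avoids \<open>0\<close> lies in an open half-space.
  The semigroup stands for the vectors that are negative for some compatible order; its closure
  under addition is what remains of the order, and it survives the elimination of a coordinate: an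
  inequality with positive and one with negative coefficient at \<open>x\<close> combine to one without \<open>x\<close>, and
  if all combinations are solvable, then so is the system, by a choice of the value at \<open>x\<close> between
  the lower and the upper bounds that it has to satisfy.
\<close>

lemma fourier_motzkin:
  fixes N B :: "(nat \<Rightarrow> int) set"
  assumes "finite A" "finite B" "B \<subseteq> N"
    and supp: "\<And>z i. z \<in> N \<Longrightarrow> i \<notin> A \<Longrightarrow> z i = 0"
    and add: "\<And>y z. y \<in> N \<Longrightarrow> z \<in> N \<Longrightarrow> (\<lambda>i. y i + z i) \<in> N"
    and zero: "(\<lambda>_. 0) \<notin> N"
  shows "\<exists>u :: nat \<Rightarrow> real. \<forall>b \<in> B. (\<Sum>i \<in> A. u i * of_int (b i)) < 0"
  using assms
proof (induction A arbitrary: B N rule: finite_induct)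
  case empty
  have "z \<notin> N" for z
    using empty.prems(3)[of z] empty.prems(5) by (metis empty_iff ext)
  with empty.prems(2) show ?case by auto
next
  case (insert x A)
  have scale: "(\<lambda>i. int (Suc k) * z i) \<in> N" if "z \<in> N" for z k
  proof (induction k)
    case (Suc k)
    then show ?case
      using insert.prems(4)[OF that Suc] by (simp add: algebra_simps)
  qed (use that in simp)
  have scale: "(\<lambda>i. k * z i) \<in> N" if "z \<in> N" "k > 0" for z k
    using scale[OF that(1), of "nat k - 1"] that(2) by simp
  \<comment> \<open>The vectors of the system with coordinate \<open>x\<close> eliminated.\<close>
  define N' where "N' = {z \<in> N. z x = 0}"
  define comb where "comb = (\<lambda>(b, c) i. (- c x) * b i + b x * c i :: int)"
  define Bp where "Bp = {b \<in> B. b x > 0}"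
  define Bn where "Bn = {b \<in> B. b x < 0}"
  define B' where "B' = {b \<in> B. b x = 0} \<union> comb ` (Bp \<times> Bn)"
  have comb_N': "comb (b, c) \<in> N'" if "b \<in> Bp" "c \<in> Bn" for b c
    using insert.prems(4)[OF scale[of b "- c x"] scale[of c "b x"]] that insert.prems(2)
    by (auto simp: N'_def Bp_def Bn_def comb_def)
  have "\<exists>u :: nat \<Rightarrow> real. \<forall>b \<in> B'. (\<Sum>i \<in> A. u i * of_int (b i)) < 0"
  proof (rule insert.IH)
    show "finite B'" using insert.prems(1) by (simp add: B'_def Bp_def Bn_def)
    show "B' \<subseteq> N'" using insert.prems(2) comb_N' by (auto simp: B'_def N'_def)
    show "z i = 0" if "z \<in> N'" "i \<notin> A" for z i
      using that insert.prems(3)[of z i] by (cases "i = x") (auto simp: N'_def)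
  qed (use insert.prems in \<open>auto simp: N'_def\<close>)
  then obtain u :: "nat \<Rightarrow> real" where u: "\<And>b. b \<in> B' \<Longrightarrow> (\<Sum>i \<in> A. u i * of_int (b i)) < 0"
    by blast
  define s where "s b = (\<Sum>i \<in> A. u i * of_int (b i))" for b :: "nat \<Rightarrow> int"
  have s_comb: "s (comb (b, c)) = (- of_int (c x)) * s b + of_int (b x) * s c" for b c
    unfolding s_def comb_def sum_distrib_left sum.distrib[symmetric]
    by (intro sum.cong) (auto simp: algebra_simps)
  obtain r where r: "\<And>l. l \<in> (\<lambda>c. - s c / of_int (c x)) ` Bn \<Longrightarrow> l < r"
      "\<And>t. t \<in> (\<lambda>b. - s b / of_int (b x)) ` Bp \<Longrightarrow> r < t"
  proof (rule real_between_finite_sets)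
    show "l < t" if l: "l \<in> (\<lambda>c. - s c / of_int (c x)) ` Bn"
      and t: "t \<in> (\<lambda>b. - s b / of_int (b x)) ` Bp" for l t
    proof -
      obtain b c where bc: "b \<in> Bp" "c \<in> Bn" "l = - s c / of_int (c x)" "t = - s b / of_int (b x)"
        using l t by auto
      then have "s (comb (b, c)) < 0"
        unfolding s_def by (intro u) (auto simp: B'_def)
      moreover have "real_of_int (b x) > 0" "real_of_int (c x) < 0"
        using bc by (auto simp: Bp_def Bn_def)
      ultimately show ?thesis
        unfolding bc(3,4) s_comb by (simp add: field_simps)
    qed
  qed (use insert.prems(1) in \<open>auto simp: Bp_def Bn_def\<close>)
  let ?u = "u(x := r)"
  have "(\<Sum>i \<in> insert x A. ?u i * of_int (b i)) < 0" if "b \<in> B" for b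
  proof -
    have "(\<Sum>i \<in> A. ?u i * of_int (b i)) = s b"
      unfolding s_def using insert.hyps(2) by (intro sum.cong) auto
    then have eq: "(\<Sum>i \<in> insert x A. ?u i * of_int (b i)) = r * of_int (b x) + s b"
      using insert.hyps by simp
    consider "b x = 0" | "b x > 0" | "b x < 0" by linarith
    then show ?thesis
    proof cases
      case 1
      then show ?thesis using u[of b] that eq by (simp add: B'_def s_def)
    next
      case 2
      then have "r < - s b / of_int (b x)" using that r(2) by (auto simp: Bp_def)
      then show ?thesis using 2 eq by (simp add: field_simps)
    next
      case 3
      then have "- s b / of_int (b x) < r" using that r(1) by (auto simp: Bn_def)
      then show ?thesis using 3 eq by (simp add: field_simps)
    qed
  qed
  then show ?case by blast
qed

lemma nat_mult_add: "nat_mult (a + b) g = nat_mult a g + nat_mult b g"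
proof -
  have "nat_mult (a + b) g = (\<Sum>_ \<in> {..<a} \<union> {a..<a+b}. g)"
    unfolding nat_mult_def by (rule sum.cong) auto
  also have "\<dots> = nat_mult a g + (\<Sum>_ \<in> {a..<a+b}. g)"
    unfolding nat_mult_def by (rule sum.union_disjoint) auto
  also have "(\<Sum>_ \<in> {a..<a+b}. g) = nat_mult b g"
    unfolding nat_mult_def
    by (rule sum.reindex_bij_witness[of _ "\<lambda>i. i + a" "\<lambda>i. i - a"]) auto
  finally show ?thesis .
qed

text \<open>
  For a linearly independent weight vector the maximum would be attained once. In general, the
  tie-break by the order of the exponents produces an order in which \<open>a\<close> is strictly the largest,
  and the differences of comparable exponents form a semigroup without \<open>0\<close>.
\<close>

lemma real_weights_for_finite_set:
  fixes h :: "(nat \<Rightarrow>\<^sub>0 nat) \<Rightarrow> 'g::linordered_ab_group_add"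
  assumes K: "finite K" "K \<noteq> {}" "\<And>b. b \<in> K \<Longrightarrow> Poly_Mapping.keys b \<subseteq> A" and A: "finite A"
    and h_add: "\<And>a b. h (a + b) = h a + h b"
  obtains a u where "a \<in> K" "h a = Max (h ` K)"
    "\<And>b. b \<in> K \<Longrightarrow> b \<noteq> a \<Longrightarrow>
      (\<Sum>i \<in> A. u i * real (Poly_Mapping.lookup b i)) < (\<Sum>i \<in> A. u i * real (Poly_Mapping.lookup a i))"
proof -
  define below where "below b a \<longleftrightarrow> h b < h a \<or> h b = h a \<and> b < a" for b a
  define diff where "diff b a i = int (Poly_Mapping.lookup b i) - int (Poly_Mapping.lookup a i)"
    for b a :: "nat \<Rightarrow>\<^sub>0 nat" and i
  \<comment> \<open>All differences of comparable exponents, not only those from \<open>K\<close>: closure under addition needs them.\<close>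
  define N where "N = {diff b a | b a. below b a \<and> Poly_Mapping.keys a \<subseteq> A \<and> Poly_Mapping.keys b \<subseteq> A}"
  define M where "M = {a \<in> K. h a = Max (h ` K)}"
  have "Max (h ` K) \<in> h ` K" using K by (intro Max_in) auto
  then have "M \<noteq> {}" by (force simp: M_def)
  have "finite M" using K by (simp add: M_def)
  define a where "a = Max M"
  have "a \<in> M" unfolding a_def using \<open>M \<noteq> {}\<close> \<open>finite M\<close> by simp
  then have a: "a \<in> K" "h a = Max (h ` K)" by (auto simp: M_def)
  have below_a: "below b a" if "b \<in> K" "b \<noteq> a" for b
  proof (cases "h b = h a")
    case True
    with that a have "b \<in> M" by (simp add: M_def)
    then have "b \<le> a" unfolding a_def using \<open>finite M\<close> by simp
    with True that show ?thesis by (simp add: below_def)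
  next
    case False
    moreover have "h b \<le> h a" unfolding a(2) using that K by simp
    ultimately show ?thesis by (simp add: below_def)
  qed
  have "\<exists>u :: nat \<Rightarrow> real. \<forall>z \<in> (\<lambda>b. diff b a) ` (K - {a}). (\<Sum>i \<in> A. u i * of_int (z i)) < 0"
  proof (rule fourier_motzkin[where N = N])
    show "(\<lambda>b. diff b a) ` (K - {a}) \<subseteq> N"
    proof
      fix z assume "z \<in> (\<lambda>b. diff b a) ` (K - {a})"
      then obtain b where "z = diff b a" "b \<in> K" "b \<noteq> a" by auto
      then show "z \<in> N" unfolding N_def using below_a K(3) a(1) by blast
    qed
    show "z i = 0" if "z \<in> N" "i \<notin> A" for z i
    proof -
      obtain b c where "z = diff b c" "Poly_Mapping.keys b \<subseteq> A" "Poly_Mapping.keys c \<subseteq> A"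
        using \<open>z \<in> N\<close> unfolding N_def by blast
      moreover from this have "i \<notin> Poly_Mapping.keys b" "i \<notin> Poly_Mapping.keys c"
        using \<open>i \<notin> A\<close> by auto
      ultimately show ?thesis by (simp add: diff_def not_in_keys_iff_lookup_eq_zero)
    qed
    show "(\<lambda>i. y i + z i) \<in> N" if yz: "y \<in> N" "z \<in> N" for y z
    proof -
      obtain b c b' c' where *: "y = diff b c" "z = diff b' c'" "below b c" "below b' c'"
        "Poly_Mapping.keys b \<subseteq> A" "Poly_Mapping.keys c \<subseteq> A"
        "Poly_Mapping.keys b' \<subseteq> A" "Poly_Mapping.keys c' \<subseteq> A"
        using yz unfolding N_def by blast
      have "below (b + b') (c + c')"
      proof -
        have "b + b' < c + c'" if "b < c" "b' < c'"
          using that by (rule add_strict_mono)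
        moreover have "h b + h b' < h c + h c'" if "h b < h c \<or> h b' < h c'"
          using that *(3,4) unfolding below_def
          by (metis add_less_le_mono add_le_less_mono less_le order_refl)
        ultimately show ?thesis
          using *(3,4) unfolding below_def h_add by fastforce
      qed
      moreover have "Poly_Mapping.keys (b + b') \<subseteq> A" "Poly_Mapping.keys (c + c') \<subseteq> A"
        using * keys_add[of b b'] keys_add[of c c'] by auto
      moreover have "(\<lambda>i. y i + z i) = diff (b + b') (c + c')"
        unfolding * by (auto simp: diff_def lookup_add)
      ultimately show ?thesis unfolding N_def by blast
    qed
    show "(\<lambda>_. 0) \<notin> N"
    proof
      assume "(\<lambda>_. 0) \<in> N"
      then obtain b c where bc: "below b c" "(\<lambda>_. 0) = diff b c" unfolding N_def by blast
      have "Poly_Mapping.lookup b i = Poly_Mapping.lookup c i" for i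
        using fun_cong[OF bc(2), of i] by (simp add: diff_def)
      then have "b = c" by (rule poly_mapping_eqI)
      with bc(1) show False by (simp add: below_def)
    qed
  qed (use A K in auto)
  then obtain u :: "nat \<Rightarrow> real" where
    u: "\<And>b. b \<in> K - {a} \<Longrightarrow> (\<Sum>i \<in> A. u i * of_int (diff b a i)) < 0"
    by blast
  have "(\<Sum>i \<in> A. u i * real (Poly_Mapping.lookup b i)) < (\<Sum>i \<in> A. u i * real (Poly_Mapping.lookup a i))"
    if "b \<in> K" "b \<noteq> a" for b
    using u[of b] that by (simp add: diff_def algebra_simps sum_subtractf)
  with a show thesis using that by blast
qed

section \<open>One-parameter families fixing a coordinate\<close>

lemma automorphism_eq_subst:
  assumes F: "alg_automorphism m F" and p: "p \<in> poly_ring m"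
  shows "F p = subst (\<lambda>i. F (var i)) p"
  using p unfolding poly_ring_eq_supported_in
proof (induction rule: supported_in_induct)
  case (const c)
  then show ?case using F by (simp add: alg_automorphism_def)
next
  case (add p q)
  then show ?case using F by (simp add: alg_automorphism_def poly_ring_eq_supported_in subst_add)
next
  case (mult p q)
  then show ?case using F by (simp add: alg_automorphism_def poly_ring_eq_supported_in subst_mult)
qed simp

text \<open>
  The automorphism and its inverse are given by the images \<open>P\<close> and \<open>Q\<close> of the variables. In this form
  they extend to polynomials in the parameter as well.
\<close>

lemma coordinateE:
  assumes "coordinate m f"
  obtains P Q i where "i \<in> {1..m}" "f = P i"
    "\<And>j. j \<in> {1..m} \<Longrightarrow> P j \<in> supported_in {1..m}"
    "\<And>j. j \<in> {1..m} \<Longrightarrow> Q j \<in> supported_in {1..m}"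
    "\<And>j. j \<in> {1..m} \<Longrightarrow> subst P (Q j) = var j"
    "\<And>j. j \<in> {1..m} \<Longrightarrow> subst Q (P j) = var j"
proof -
  obtain F i where F: "alg_automorphism m F" and i: "i \<in> {1..m}" "f = F (var i)"
    using assms by (auto simp: coordinate_def)
  let ?S = "supported_in {1..m} :: 'a mpol set"
  have bij: "bij_betw F ?S ?S"
    using F by (simp add: alg_automorphism_def poly_ring_eq_supported_in)
  define P where "P j = F (var j)" for j
  define Q where "Q j = inv_into ?S F (var j)" for j
  have F_subst: "F p = subst P p" if "p \<in> ?S" for p
    using automorphism_eq_subst[OF F] that by (simp add: poly_ring_eq_supported_in P_def[abs_def])
  have P: "P j \<in> ?S" if "j \<in> {1..m}" for j
    unfolding P_def using bij_betwE[OF bij] supported_in_closed(2)[OF that] by blast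
  have Q: "Q j \<in> ?S" "subst P (Q j) = var j" if "j \<in> {1..m}" for j
  proof -
    have var: "var j \<in> F ` ?S"
      using bij supported_in_closed(2)[OF that] by (simp add: bij_betw_def)
    show "Q j \<in> ?S" unfolding Q_def by (rule inv_into_into[OF var])
    then show "subst P (Q j) = var j"
      using f_inv_into_f[OF var] F_subst unfolding Q_def by metis
  qed
  have "subst Q (P j) = var j" if j: "j \<in> {1..m}" for j
  proof -
    have in_S: "subst Q (P j) \<in> ?S"
      using P[OF j] Q(1) by (rule subst_in_supported_in)
    have "F (subst Q (P j)) = subst (\<lambda>l. subst P (Q l)) (P j)"
      using F_subst[OF in_S] by (simp add: subst_subst)
    also have "\<dots> = F (var j)"
      using subst_id[OF P[OF j]] Q(2) by (simp add: P_def)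
    finally show ?thesis
      using bij in_S supported_in_closed(2)[OF j] by (auto simp: bij_betw_def inj_on_def)
  qed
  with that[of i P Q] i P Q show thesis by (simp add: P_def)
qed

text \<open>
  Invariance under \<open>x\<^sub>j \<mapsto> x\<^sub>j + t\<close> rules out \<open>x\<^sub>j\<close> in every characteristic when \<open>t\<close> is a free
  variable: the substitution \<open>x\<^sub>j \<mapsto> 0, t \<mapsto> x\<^sub>j\<close> sends the shifted polynomial back to \<open>q\<close> and \<open>q\<close>
  itself to a polynomial without \<open>x\<^sub>j\<close>.
\<close>

lemma no_shift_invariance:
  assumes q: "q \<in> supported_in A" "0 \<notin> A" and j: "j \<noteq> 0"
    and inv: "subst (var(j := var j + var 0)) q = q"
  shows "q \<in> supported_in (A - {j})"
proof -
  let ?\<tau> = "var(j := 0, 0 := var j)"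
  have "subst ?\<tau> (subst (var(j := var j + var 0)) q) = q"
    unfolding subst_subst using q(1)
    by (rule subst_id) (use q(2) j in \<open>auto simp: subst_add\<close>)
  moreover have "subst ?\<tau> q \<in> supported_in (A - {j})"
    using q(1)
  proof (rule subst_in_supported_in)
    show "?\<tau> i \<in> supported_in (A - {j})" if "i \<in> A" for i
      using that q(2) supported_in_closed(1)[of 0 "A - {j}"] supported_in_closed(2)[of i "A - {j}"] by auto
  qed
  ultimately show ?thesis using inv by simp
qed

text \<open>
  The families are the conjugates of the shifts \<open>x\<^sub>j \<mapsto> x\<^sub>j + t\<close>, where \<open>j\<close> is not the index \<open>i\<close> of the
  variable mapped to \<open>f\<close>. If all of them fixed \<open>x\<^sub>k\<close>, then the preimage of \<open>x\<^sub>k\<close> would be a polynomial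
  in \<open>x\<^sub>i\<close> alone and \<open>x\<^sub>k\<close> a polynomial in \<open>f\<close>.
\<close>

lemma coordinate_shift_family:
  assumes f: "coordinate m f" and k: "k \<in> {1..m}"
    and not_poly: "\<And>j q. q \<in> supported_in {j} \<Longrightarrow> subst (\<lambda>_. f) q \<noteq> var k"
  obtains R where "subst R f = f" "R k \<noteq> var k"
    "\<And>i. i \<in> {1..m} \<Longrightarrow> subst (var(0 := 0)) (R i) = var i"
proof -
  obtain P Q i where PQ: "i \<in> {1..m}" "f = P i"
    and P: "\<And>j. j \<in> {1..m} \<Longrightarrow> P j \<in> supported_in {1..m}"
    and Q: "\<And>j. j \<in> {1..m} \<Longrightarrow> Q j \<in> supported_in {1..m}"
    and P_Q: "\<And>j. j \<in> {1..m} \<Longrightarrow> subst P (Q j) = var j"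
    and Q_P: "\<And>j. j \<in> {1..m} \<Longrightarrow> subst Q (P j) = var j"
    using coordinateE[OF f] by metis
  define S :: "nat \<Rightarrow> nat \<Rightarrow> 'a mpol" where "S j = var(j := var j + var 0)" for j
  define P' where "P' = P(0 := var 0)"
  define R where "R j l = subst P' (subst (S j) (Q l))" for j l
  have P'_id: "subst (Q(0 := var 0)) (subst P' p) = p" if "p \<in> supported_in {0..m}" for p
    unfolding subst_subst using that
  proof (rule subst_id)
    fix l assume l: "l \<in> {0..m}"
    show "subst (Q(0 := var 0)) (P' l) = var l"
    proof (cases "l = 0")
      case False
      then have "subst (Q(0 := var 0)) (P l) = subst Q (P l)"
        using l by (intro subst_cong[OF P]) auto
      then show ?thesis using False l Q_P by (simp add: P'_def)
    qed (simp add: P'_def)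
  qed
  have S_in: "subst (S j) (Q l) \<in> supported_in {0..m}" if "j \<in> {1..m}" "l \<in> {1..m}" for j l
    using Q[OF that(2)]
    by (rule subst_in_supported_in) (use that in \<open>auto simp: S_def intro!: supported_in_closed\<close>)
  have "\<exists>j \<in> {1..m} - {i}. R j k \<noteq> var k"
  proof (rule ccontr)
    assume "\<not> ?thesis"
    then have R: "R j k = var k" if "j \<in> {1..m} - {i}" for j using that by blast
    have "subst (S j) (Q k) = Q k" if "j \<in> {1..m} - {i}" for j
    proof -
      have "subst (S j) (Q k) = subst (Q(0 := var 0)) (R j k)"
        unfolding R_def using that k by (intro P'_id[symmetric] S_in) auto
      then show ?thesis using k by (simp add: R[OF that])
    qed
    then have "Q k \<in> supported_in ({1..m} - {j})" if "j \<in> {1..m} - {i}" for j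
      using no_shift_invariance[OF Q[OF k], of j] that by (auto simp: S_def)
    then have "Q k \<in> supported_in {i}"
      using Q[OF k] unfolding supported_in_def by blast
    moreover from this have "subst (\<lambda>_. f) (Q k) = subst P (Q k)"
      by (rule subst_cong) (simp add: PQ(2))
    ultimately show False
      using not_poly P_Q[OF k] by simp
  qed
  then obtain j where j: "j \<in> {1..m}" "j \<noteq> i" "R j k \<noteq> var k" by blast
  have "subst (R j) f = subst P' (subst (S j) (subst Q f))"
    by (simp add: R_def[abs_def] subst_subst)
  also have "\<dots> = f"
    using PQ j Q_P[OF PQ(1)] by (simp add: S_def P'_def)
  finally have "subst (R j) f = f" .
  moreover have "subst (var(0 := 0)) (R j l) = var l" if l: "l \<in> {1..m}" for l
  proof -
    have zero_P': "subst (var(0 := 0)) (P' r) = P r" if "r \<in> {1..m}" for r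
      using subst_id[OF P[OF that]] that by (simp add: P'_def)
    have "subst (var(0 := 0)) (R j l)
        = subst (\<lambda>r. subst (var(0 := 0)) (subst P' (S j r))) (Q l)"
      by (simp add: R_def subst_subst)
    also have "\<dots> = subst P (Q l)"
      using Q[OF l]
    proof (rule subst_cong)
      fix r assume r: "r \<in> {1..m}"
      have "subst (var(0 := 0)) (subst P' (var 0)) = 0"
        by (simp add: P'_def)
      then show "subst (var(0 := 0)) (subst P' (S j r)) = P r"
        using zero_P'[OF r] by (cases "r = j") (simp_all add: S_def subst_add)
    qed
    finally show ?thesis using P_Q[OF l] by simp
  qed
  ultimately show thesis using that j(3) by blast
qed

section \<open>Vertices of the Newton polytope\<close>

text \<open>
  In terms of degrees in \<open>x\<^sub>l\<close>: \<open>f\<close> has positive degree and \<open>x\<^sub>k\<close> has degree \<open>0\<close>, so only a constant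
  polynomial in \<open>f\<close> could equal \<open>x\<^sub>k\<close>.
\<close>

lemma var_not_polynomial_in:
  fixes f :: "'a::idom mpol"
  assumes a: "a \<in> Poly_Mapping.keys f" "Poly_Mapping.lookup a l \<noteq> 0" "l \<noteq> k"
    and q: "q \<in> supported_in {j}"
  shows "subst (\<lambda>_. f) q \<noteq> var k"
proof
  assume eq: "subst (\<lambda>_. f) q = var k"
  define v :: "nat \<Rightarrow> real" where "v = (\<lambda>_. 0)(l := 1)"
  have "f \<noteq> 0" using a(1) by auto
  then obtain d where d: "has_degree v f d" by (rule has_degree_exists)
  have "weight v a = (\<Sum>i \<in> Poly_Mapping.keys a. if i = l then real (Poly_Mapping.lookup a i) else 0)"
    unfolding weight_def v_def by (intro sum.cong) auto
  also have "\<dots> > 0" using a(2) by (simp add: in_keys_iff)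
  finally have "d > 0" using d a(1) by (force simp: has_degree_def)
  have "(var k :: 'a mpol) \<noteq> 0" by (rule has_degree_nonzero[OF has_degree_var])
  then have "Poly_Mapping.keys q \<noteq> {}" using eq by auto
  let ?e = "\<lambda>b. Poly_Mapping.lookup b j"
  obtain b where b: "b \<in> Poly_Mapping.keys q" "\<And>b'. b' \<in> Poly_Mapping.keys q \<Longrightarrow> ?e b' \<le> ?e b"
  proof -
    have "Max (?e ` Poly_Mapping.keys q) \<in> ?e ` Poly_Mapping.keys q"
      using \<open>Poly_Mapping.keys q \<noteq> {}\<close> by (intro Max_in) auto
    then obtain b where "b \<in> Poly_Mapping.keys q" "?e b = Max (?e ` Poly_Mapping.keys q)" by force
    then show thesis using that[of b] by simp
  qed
  have sub: "Poly_Mapping.keys b' \<subseteq> {j}" if "b' \<in> Poly_Mapping.keys q" for b'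
    using q that by (auto simp: supported_in_def)
  have weight_q: "weight (\<lambda>_. d) b' = real (?e b') * d" if "b' \<in> Poly_Mapping.keys q" for b'
    using weight_superset[of "{j}" b' "\<lambda>_. d"] sub[OF that] by simp
  have eq_if: "b' = b''" if "b' \<in> Poly_Mapping.keys q" "b'' \<in> Poly_Mapping.keys q" "?e b' = ?e b''" for b' b''
  proof (rule poly_mapping_eqI)
    fix i
    have "i \<notin> Poly_Mapping.keys b'" "i \<notin> Poly_Mapping.keys b''" if "i \<noteq> j"
      using sub[OF \<open>b' \<in> _\<close>] sub[OF \<open>b'' \<in> _\<close>] that by auto
    then show "Poly_Mapping.lookup b' i = Poly_Mapping.lookup b'' i"
      using that(3) by (cases "i = j") (simp_all add: not_in_keys_iff_lookup_eq_zero)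
  qed
  have "has_degree v (subst (\<lambda>_. f) q) (weight (\<lambda>_. d) b)"
    using q d b(1)
  proof (rule has_degree_subst)
    fix b' assume b': "b' \<in> Poly_Mapping.keys q" "b' \<noteq> b"
    then have "?e b' < ?e b" using b eq_if by (metis le_neq_implies_less)
    then show "weight (\<lambda>_. d) b' < weight (\<lambda>_. d) b"
      using \<open>d > 0\<close> by (simp add: weight_q b' b(1))
  qed
  then have "real (?e b) * d = v k"
    unfolding eq weight_q[OF b(1)] by (rule has_degree_unique[OF _ has_degree_var])
  then have "?e b = 0" using a(3) \<open>d > 0\<close> by (simp add: v_def)
  then have "Poly_Mapping.keys b' \<subseteq> {}" if "b' \<in> Poly_Mapping.keys q" for b'
  proof -
    have "j \<notin> Poly_Mapping.keys b'"
      unfolding not_in_keys_iff_lookup_eq_zero using b(2)[OF that] \<open>?e b = 0\<close> by simp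
    then show ?thesis using sub[OF that] by blast
  qed
  then have "q \<in> supported_in {}"
    by (simp add: supported_in_def)
  moreover from this have "subst (\<lambda>_. f) q = subst var q" by (rule subst_cong) simp
  ultimately have "var k \<in> (supported_in {} :: 'a mpol set)"
    using subst_id[of q "{}" var] eq by simp
  then show False by (simp add: supported_in_def var_def del: keys_eq_empty)
qed

lemma weight_fun_upd:
  "weight (u(j := r)) c = weight u c + real (Poly_Mapping.lookup c j) * (r - u j)"
proof -
  let ?S = "insert j (Poly_Mapping.keys c)"
  have w: "weight v c = (\<Sum>i \<in> ?S. real (Poly_Mapping.lookup c i) * v i)" for v
    by (rule weight_superset) auto
  have "weight (u(j := r)) c - weight u c
      = (\<Sum>i \<in> ?S. real (Poly_Mapping.lookup c i) * ((u(j := r)) i - u i))"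
    unfolding w sum_subtractf[symmetric] right_diff_distrib ..
  also have "\<dots> = (\<Sum>i \<in> ?S. if i = j then real (Poly_Mapping.lookup c j) * (r - u j) else 0)"
    by (intro sum.cong) auto
  finally show ?thesis by simp
qed

text \<open>
  Moving the weight of \<open>t\<close> slightly past its critical value raises the degrees of some \<open>R\<^sub>i\<close> by a
  tiny amount. The degree of \<open>f\<close> would rise with them if \<open>a\<close> had only positive entries, contrary to
  the invariance of \<open>f\<close>.
\<close>

lemma invariant_top_exponent_has_zero:
  fixes f :: "'a::idom mpol" and R :: "nat \<Rightarrow> 'a mpol"
  assumes A: "finite A" "0 \<notin> A" and f: "f \<in> supported_in A" and a: "a \<in> Poly_Mapping.keys f"
    and top: "\<And>b. b \<in> Poly_Mapping.keys f \<Longrightarrow> b \<noteq> a \<Longrightarrow> weight u b < weight u a"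
    and fixed: "subst R f = f"
    and at_zero: "\<And>i. i \<in> A \<Longrightarrow> subst (var(0 := 0)) (R i) = var i"
    and moves: "k \<in> A" "R k \<noteq> var k"
  shows "\<exists>i \<in> A. Poly_Mapping.lookup a i = 0"
proof (rule ccontr)
  assume "\<not> ?thesis"
  then have a_pos: "\<And>i. i \<in> A \<Longrightarrow> Poly_Mapping.lookup a i > 0" by auto
  have keys_A: "Poly_Mapping.keys b \<subseteq> A" if "b \<in> Poly_Mapping.keys f" for b
    using f that by (simp add: supported_in_def)
  define u0 where "u0 = u(0 := 0)"
  \<comment> \<open>The exponent of the parameter \<open>t\<close>.\<close>
  let ?e = "\<lambda>c. Poly_Mapping.lookup c 0"
  define T where "T = Sigma A (\<lambda>i. {c \<in> Poly_Mapping.keys (R i). ?e c > 0})"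
  have "finite T" using A(1) by (simp add: T_def)
  have key0: "c = Poly_Mapping.single i 1" if "i \<in> A" "c \<in> Poly_Mapping.keys (R i)" "?e c = 0" for i c
  proof -
    have "c \<in> Poly_Mapping.keys (var i :: 'a mpol)"
      unfolding in_keys_iff at_zero[OF that(1), symmetric] lookup_subst_var_zero[OF that(3)]
      using that(2) by (simp add: in_keys_iff)
    then show ?thesis by (simp add: var_def)
  qed
  have key1: "Poly_Mapping.single i 1 \<in> Poly_Mapping.keys (R i)" if "i \<in> A" for i
  proof -
    have "Poly_Mapping.lookup (Poly_Mapping.single i (1 :: nat)) 0 = 0"
      by (rule lookup_single_not_eq) (use that A(2) in metis)
    from lookup_subst_var_zero[OF this, of "R i"] show ?thesis
      by (simp add: at_zero[OF that] in_keys_iff var_def)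
  qed
  have "T \<noteq> {}"
  proof
    assume "T = {}"
    have "0 \<notin> Poly_Mapping.keys c" if "c \<in> Poly_Mapping.keys (R k)" for c
    proof
      assume "0 \<in> Poly_Mapping.keys c"
      then have "(k, c) \<in> T"
        using that moves(1) by (simp add: T_def in_keys_iff)
      with \<open>T = {}\<close> show False by simp
    qed
    then have "R k \<in> supported_in (UNIV - {0})"
      unfolding supported_in_def by blast
    then have "subst (var(0 := 0)) (R k) = R k"
      by (rule subst_id) auto
    with moves at_zero show False by simp
  qed

  \<comment> \<open>The weight of \<open>t\<close> at which the term \<open>c\<close> of \<open>R i\<close> reaches the weight of \<open>x\<^sub>i\<close>; the smallest of these
    is the first at which the degree of any \<open>R i\<close> is about to change.\<close>
  define crit where "crit = (\<lambda>(i, c). (u i - weight u0 c) / real (?e c))"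
  define \<nu> where "\<nu> = Min (crit ` T)"
  have "\<nu> \<in> crit ` T" unfolding \<nu>_def using \<open>finite T\<close> \<open>T \<noteq> {}\<close> by (intro Min_in) auto
  then obtain i1 c1 where ic: "(i1, c1) \<in> T" "\<nu> = crit (i1, c1)" by auto
  have \<nu>_le: "weight u0 c + real (?e c) * \<nu> \<le> u i" if "(i, c) \<in> T" for i c
  proof -
    have "\<nu> \<le> crit (i, c)" unfolding \<nu>_def using \<open>finite T\<close> that by (intro Min_le) auto
    then show ?thesis using that by (simp add: crit_def T_def field_simps)
  qed
  have \<nu>_eq: "weight u0 c1 + real (?e c1) * \<nu> = u i1"
    using ic by (simp add: crit_def T_def field_simps)

  define C where "C = Max ((\<lambda>(i, c). ?e c) ` T)"
  have C: "?e c \<le> C" if "(i, c) \<in> T" for i c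
    unfolding C_def using \<open>finite T\<close> that by (intro Max_ge) force+
  have "C > 0" using C[OF ic(1)] ic(1) by (simp add: T_def)
  let ?size = "weight (\<lambda>_. 1)"
  have size_nonneg: "?size b \<ge> 0" for b by (simp add: weight_def sum_nonneg)
  \<comment> \<open>Small enough that \<open>a\<close> stays the unique heaviest exponent when each weight grows by at most \<open>\<epsilon>\<close>;
    adding \<open>1\<close> keeps the denominator positive for the exponent \<open>0\<close>.\<close>
  obtain \<epsilon> where \<epsilon>: "\<And>l. l \<in> {0} \<Longrightarrow> l < \<epsilon>"
    "\<And>t. t \<in> (\<lambda>b. (weight u a - weight u b) / (?size b + 1)) ` (Poly_Mapping.keys f - {a}) \<Longrightarrow> \<epsilon> < t"
  proof (rule real_between_finite_sets)
    fix l t :: real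
    assume "l \<in> {0}" and t: "t \<in> (\<lambda>b. (weight u a - weight u b) / (?size b + 1)) ` (Poly_Mapping.keys f - {a})"
    then show "l < t" using top size_nonneg
      by (auto intro!: divide_pos_pos simp: add_nonneg_pos)
  qed auto
  have "\<epsilon> > 0" using \<epsilon>(1) by simp
  have gap: "weight u b + \<epsilon> * ?size b < weight u a" if "b \<in> Poly_Mapping.keys f" "b \<noteq> a" for b
  proof -
    have "\<epsilon> < (weight u a - weight u b) / (?size b + 1)" using that \<epsilon>(2) by blast
    then have "\<epsilon> * (?size b + 1) < weight u a - weight u b"
      using size_nonneg[of b] by (simp add: pos_less_divide_eq)
    then show ?thesis using \<open>\<epsilon> > 0\<close> by (simp add: algebra_simps)
  qed

  \<comment> \<open>A term contains \<open>t\<close> at most \<open>C\<close> times, so its weight grows by at most \<open>C * \<delta> = \<epsilon>\<close>.\<close>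
  define \<delta> where "\<delta> = \<epsilon> / real C"
  have "\<delta> > 0" using \<open>\<epsilon> > 0\<close> \<open>C > 0\<close> by (simp add: \<delta>_def)
  define v where "v = u(0 := \<nu> + \<delta>)"
  have weight_v: "weight v c = weight u0 c + real (?e c) * \<nu> + real (?e c) * \<delta>" for c
    unfolding v_def u0_def weight_fun_upd by (simp add: algebra_simps)
  have weight_single: "weight v (Poly_Mapping.single i 1) = u i" if "i \<in> A" for i
    using that A(2) by (auto simp: weight_def v_def)
  have "\<exists>d. \<forall>i \<in> A. has_degree v (R i) (d i)"
  proof -
    have "\<exists>d. has_degree v (R i) d" if "i \<in> A" for i
    proof -
      have "R i \<noteq> 0" using key1[OF that] by auto
      then show ?thesis using has_degree_exists by blast
    qed
    then show ?thesis by metis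
  qed
  then obtain d where d: "\<And>i. i \<in> A \<Longrightarrow> has_degree v (R i) (d i)" by blast
  have d_lower: "u i \<le> d i" if "i \<in> A" for i
    using d[OF that] key1[OF that] weight_single[OF that] by (force simp: has_degree_def)
  have d_upper: "d i \<le> u i + \<epsilon>" if i: "i \<in> A" for i
  proof -
    obtain c where c: "c \<in> Poly_Mapping.keys (R i)" "weight v c = d i"
      using d[OF i] by (auto simp: has_degree_def)
    show ?thesis
    proof (cases "?e c = 0")
      case True
      then show ?thesis using key0[OF i c(1)] weight_single[OF i] c(2) \<open>\<epsilon> > 0\<close> by simp
    next
      case False
      then have T: "(i, c) \<in> T" using i c by (simp add: T_def)
      have "real (?e c) * \<delta> \<le> real C * \<delta>"
        using C[OF T] \<open>\<delta> > 0\<close> by simp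
      also have "\<dots> = \<epsilon>" using \<open>C > 0\<close> by (simp add: \<delta>_def)
      finally show ?thesis using \<nu>_le[OF T] c(2) by (simp add: weight_v)
    qed
  qed
  have d_strict: "u i1 < d i1"
  proof -
    have "u i1 < weight v c1"
      using \<nu>_eq ic(1) \<open>\<delta> > 0\<close> by (simp add: weight_v T_def)
    also have "\<dots> \<le> d i1"
      using d[of i1] ic(1) by (auto simp: has_degree_def T_def)
    finally show ?thesis .
  qed

  have weight_A: "weight x b = (\<Sum>i \<in> A. real (Poly_Mapping.lookup b i) * x i)"
    if "b \<in> Poly_Mapping.keys f" for b x
    using A(1) keys_A[OF that] by (rule weight_superset)
  have "has_degree v (subst R f) (weight d a)"
    using f d a
  proof (rule has_degree_subst)
    fix b assume b: "b \<in> Poly_Mapping.keys f" "b \<noteq> a"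
    have "weight d b \<le> weight u b + \<epsilon> * ?size b"
      unfolding weight_A[OF b(1)] sum_distrib_left sum.distrib[symmetric]
    proof (rule sum_mono)
      fix i assume "i \<in> A"
      from mult_left_mono[OF d_upper[OF this], of "real (Poly_Mapping.lookup b i)"]
      show "real (Poly_Mapping.lookup b i) * d i
          \<le> real (Poly_Mapping.lookup b i) * u i + \<epsilon> * (real (Poly_Mapping.lookup b i) * 1)"
        by (simp add: algebra_simps)
    qed
    also have "\<dots> < weight u a" using gap[OF b] .
    also have "\<dots> \<le> weight d a"
      unfolding weight_A[OF a] by (intro sum_mono mult_left_mono d_lower) auto
    finally show "weight d b < weight d a" .
  qed
  moreover have "has_degree v f (weight u a)"
  proof -
    have weight_eq: "weight v b = weight u b" if "b \<in> Poly_Mapping.keys f" for b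
      unfolding weight_A[OF that] using A(2) by (intro sum.cong) (auto simp: v_def)
    show ?thesis
      unfolding has_degree_def using a top weight_eq by (metis less_eq_real_def)
  qed
  ultimately have "weight d a = weight u a"
    unfolding fixed by (rule has_degree_unique)
  moreover have "weight u a < weight d a"
    unfolding weight_A[OF a] using A(1)
  proof (rule sum_strict_mono_ex1)
    show "\<forall>i \<in> A. real (Poly_Mapping.lookup a i) * u i \<le> real (Poly_Mapping.lookup a i) * d i"
      using d_lower by (auto intro: mult_left_mono)
    show "\<exists>i \<in> A. real (Poly_Mapping.lookup a i) * u i < real (Poly_Mapping.lookup a i) * d i"
      using ic(1) d_strict a_pos by (intro bexI[of _ i1]) (auto simp: T_def)
  qed
  ultimately show False by simp
qed

section \<open>Weighted degrees of stable coordinates\<close>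

theorem theorem1p3:
  fixes n :: nat
    and f :: "'k::idom mpol"
    and w :: "nat \<Rightarrow> 'g::linordered_ab_group_add"
  assumes "n \<ge> 2"
    and "stable_coordinate n f"
  shows "\<exists>i \<in> {1..n}. wdeg n w f \<in> weight_sums ({1..n} - {i}) w"
proof -
  obtain m where f: "f \<in> supported_in {1..n}" and m: "m \<ge> n" "coordinate m f"
    using assms(2) by (auto simp: stable_coordinate_def poly_ring_eq_supported_in)
  have "f \<noteq> 0"
  proof
    assume "f = 0"
    obtain P Q :: "nat \<Rightarrow> 'k mpol" and i where "f = P i" "subst Q (P i) = var i"
      using coordinateE[OF m(2)] by metis
    then have "(var i :: 'k mpol) = 0" using \<open>f = 0\<close> by auto
    then show False using has_degree_nonzero[OF has_degree_var] by blast
  qed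
  define h where "h a = (\<Sum>i = 1..n. nat_mult (Poly_Mapping.lookup a i) (w i))" for a
  have h_add: "h (a + b) = h a + h b" for a b
    by (simp add: h_def lookup_add nat_mult_add sum.distrib)
  have K: "Poly_Mapping.keys f \<noteq> {}" "\<And>b. b \<in> Poly_Mapping.keys f \<Longrightarrow> Poly_Mapping.keys b \<subseteq> {1..n}"
    using \<open>f \<noteq> 0\<close> f by (auto simp: supported_in_def)
  obtain a u where a: "a \<in> Poly_Mapping.keys f" and ha: "h a = Max (h ` Poly_Mapping.keys f)"
    and u: "\<And>b. b \<in> Poly_Mapping.keys f \<Longrightarrow> b \<noteq> a \<Longrightarrow>
      (\<Sum>i = 1..n. u i * real (Poly_Mapping.lookup b i)) < (\<Sum>i = 1..n. u i * real (Poly_Mapping.lookup a i))"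
    using real_weights_for_finite_set[of "Poly_Mapping.keys f" "{1..n}" h] K h_add by auto
  have top: "weight u b < weight u a" if "b \<in> Poly_Mapping.keys f" "b \<noteq> a" for b
    using u[OF that] weight_superset[of "{1..n}" _ u] K(2) that(1) a by (simp add: mult.commute)
  have "\<exists>i \<in> {1..n}. Poly_Mapping.lookup a i = 0"
  proof (rule ccontr)
    assume no: "\<not> ?thesis"
    \<comment> \<open>By assumption \<open>x\<^sub>2\<close> occurs in \<open>f\<close>; this is where \<open>n \<ge> 2\<close> enters.\<close>
    have "subst (\<lambda>_. f) q \<noteq> var 1" if "q \<in> supported_in {j}" for j q
      using var_not_polynomial_in[OF a _ _ that, of 2 1] no assms(1) by auto
    then obtain R where R: "subst R f = f" "R 1 \<noteq> var 1"
      "\<And>i. i \<in> {1..m} \<Longrightarrow> subst (var(0 := 0)) (R i) = var i"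
      using coordinate_shift_family[OF m(2), of 1] m(1) assms(1) by auto
    have "\<exists>i \<in> {1..n}. Poly_Mapping.lookup a i = 0"
      using _ _ f a top R(1) _ _ R(2)
      by (rule invariant_top_exponent_has_zero) (use R(3) m(1) assms(1) in auto)
    with no show False ..
  qed
  then obtain i where i: "i \<in> {1..n}" "Poly_Mapping.lookup a i = 0" by blast
  have "wdeg n w f = h a"
    unfolding ha by (simp add: wdeg_def h_def)
  also have "h a = (\<Sum>l \<in> {1..n} - {i}. nat_mult (Poly_Mapping.lookup a l) (w l))"
    unfolding h_def using i by (subst sum.remove[of _ i]) (auto simp: nat_mult_def)
  also have "\<dots> \<in> weight_sums ({1..n} - {i}) w"
    by (auto simp: weight_sums_def)
  finally show ?thesis using i(1) by blast
qed

end
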